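(* Let $d\ge1$ be a constant and $C>0$ a constant. Consider the store-and-forward packet routing problem on a $d$-dimensional uni-directional grid $G$ with $n$ nodes, uniform link capacity $c$ and uniform buffer size $B$. Let $\nu = 2n(d+B/c)$, $p_{\max} = (\nu+2)\cdot\mathrm{diam}(G)$ and $k=\lceil \log_2(1+3p_{\max})\rceil$. If $B/c \le n^{C}$ and $B, c \ge k$, then there exists an online deterministic centralized packet-routing algorithm with competitive ratio $O(\log n)$ in which every packet is either rejected upon arrival or delivered (no packet is preempted).
   Context: Store-and-forward packet routing model. The network is a directed graph $G=(V,E)$ with $n=|V|$ nodes; each edge can carry at most $c$ packets per time step (traversal takes one time step); each node can store at most $B$ packets. Time is discrete and synchronous. Each request $r_i=(a_i,b_i,t_i,d_i)$ has source $a_i$, destination $b_i$, input time $t_i$ (the packet is input at $a_i$ via a local input; any number per node per step) and deadline $d_i$ (possibly $\infty$). In each time step each node delivers packets destined to it, forwards at most $c$ of the other present packets along each outgoing edge, stores at most $B$, and deletes the rest. Deleting a locally input packet is rejection; deleting an injected packet before delivery is preemption. Throughput = number of packets delivered by their deadline. An online algorithm learns nothing about $r_i$ before $t_i$. A deterministic online ALG is $\rho$-competitive if $|\mathrm{ALG}(\sigma)|\ge\frac1\rho|\mathrm{OPT}(\sigma)|$ for all inputs $\sigma$, with $|\mathrm{OPT}(\sigma)|$ the maximum achievable throughput. A $d$-dimensional uni-directional grid has vertex set $[\ell_1]\times\cdots\times[\ell_d]$, $n=\prod_j\ell_j$, with a directed edge from $x$ to $x+e_j$ for each coordinate $j$ whenever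 both are vertices; requests satisfy $a_i\le b_i$ coordinatewise. $\mathrm{diam}(G)$ is the maximum over pairs $u,v$ with a directed path from $u$ to $v$ of the length of a shortest such path. *)

theory Defs
  imports Complex_Main "HOL-Library.Extended_Nat"
begin

type_synonym node = "nat list"

definition is_path :: "(node \<times> node) set \<Rightarrow> node list \<Rightarrow> bool" where
  "is_path E p \<longleftrightarrow> p \<noteq> [] \<and> (\<forall>i. Suc i < length p \<longrightarrow> (p ! i, p ! Suc i) \<in> E)"

definition reachable :: "(node \<times> node) set \<Rightarrow> node \<Rightarrow> node \<Rightarrow> bool" where
  "reachable E u v \<longleftrightarrow> (\<exists>p. is_path E p \<and> hd p = u \<and> last p = v)"

definition gdist :: "(node \<times> node) set \<Rightarrow> node \<Rightarrow> node \<Rightarrow> nat" where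
  "gdist E u v = (LEAST m. \<exists>p. is_path E p \<and> hd p = u \<and> last p = v \<and> length p = Suc m)"

definition diam :: "node set \<Rightarrow> (node \<times> node) set \<Rightarrow> nat" where
  "diam V E = Max {gdist E u v | u v. u \<in> V \<and> v \<in> V \<and> reachable E u v}"

definition grid_V :: "nat list \<Rightarrow> node set" where
  "grid_V ls = {x. length x = length ls \<and> (\<forall>j<length ls. x ! j < ls ! j)}"

definition grid_E :: "nat list \<Rightarrow> (node \<times> node) set" where
  "grid_E ls = {(x, x[j := Suc (x ! j)]) | x j.
      x \<in> grid_V ls \<and> j < length ls \<and> x[j := Suc (x ! j)] \<in> grid_V ls}"

definition grid_n :: "nat list \<Rightarrow> nat" where
  "grid_n ls = prod_list ls"

datatype request = Req (src: node) (dst: node) (tin: nat) (dl: enat)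

definition valid_request :: "nat list \<Rightarrow> request \<Rightarrow> bool" where
  "valid_request ls r \<longleftrightarrow> src r \<in> grid_V ls \<and> dst r \<in> grid_V ls \<and>
      (\<forall>j<length ls. src r ! j \<le> dst r ! j)"

definition valid_input :: "nat list \<Rightarrow> request list \<Rightarrow> bool" where
  "valid_input ls \<sigma> \<longleftrightarrow> (\<forall>r\<in>set \<sigma>. valid_request ls r) \<and> sorted (map tin \<sigma>)"

text \<open>A schedule assigns to every packet i its trajectory ws!i: the list of nodes
  where it is present at times tin i, tin i + 1, ...  Between consecutive times the
  packet either traverses an edge or is stored at the node.  The packet is delivered
  the moment it is present at its destination (so the destination can only be the
  last entry); if the last entry is not the destination, the packet is deleted at
  that time step (rejection if the trajectory is just the source, preemption else).\<close>
definition valid_traj :: "(node \<times> node) set \<Rightarrow> request \<Rightarrow> node list \<Rightarrow> bool" where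
  "valid_traj E r p \<longleftrightarrow> p \<noteq> [] \<and> hd p = src r \<and> dst r \<notin> set (butlast p) \<and>
      (\<forall>i. Suc i < length p \<longrightarrow> ((p ! i, p ! Suc i) \<in> E \<or> p ! i = p ! Suc i))"

text \<open>Packets that go from u to v during time step \<tau> (from time \<tau> to \<tau>+1);
  for u = v these are the packets stored at u during step \<tau>.\<close>
definition steps :: "request list \<Rightarrow> node list list \<Rightarrow> nat \<Rightarrow> node \<Rightarrow> node \<Rightarrow> nat set" where
  "steps \<sigma> ws \<tau> u v = {i. i < length \<sigma> \<and> tin (\<sigma> ! i) \<le> \<tau> \<and>
      Suc (\<tau> - tin (\<sigma> ! i)) < length (ws ! i) \<and>
      ws ! i ! (\<tau> - tin (\<sigma> ! i)) = u \<and> ws ! i ! Suc (\<tau> - tin (\<sigma> ! i)) = v}"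

definition feasible :: "(node \<times> node) set \<Rightarrow> nat \<Rightarrow> nat \<Rightarrow> request list \<Rightarrow> node list list \<Rightarrow> bool" where
  "feasible E c B \<sigma> ws \<longleftrightarrow> length ws = length \<sigma> \<and>
      (\<forall>i<length \<sigma>. valid_traj E (\<sigma> ! i) (ws ! i)) \<and>
      (\<forall>\<tau> u v. (u, v) \<in> E \<longrightarrow> card (steps \<sigma> ws \<tau> u v) \<le> c) \<and>
      (\<forall>\<tau> v. card (steps \<sigma> ws \<tau> v v) \<le> B)"

definition delivered_in_time :: "request list \<Rightarrow> node list list \<Rightarrow> nat set" where
  "delivered_in_time \<sigma> ws = {i. i < length \<sigma> \<and> last (ws ! i) = dst (\<sigma> ! i) \<and>
      enat (tin (\<sigma> ! i) + length (ws ! i) - 1) \<le> dl (\<sigma> ! i)}"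

definition throughput :: "request list \<Rightarrow> node list list \<Rightarrow> nat" where
  "throughput \<sigma> ws = card (delivered_in_time \<sigma> ws)"

definition OPT :: "(node \<times> node) set \<Rightarrow> nat \<Rightarrow> nat \<Rightarrow> request list \<Rightarrow> nat" where
  "OPT E c B \<sigma> = Max {throughput \<sigma> ws | ws. feasible E c B \<sigma> ws}"

definition no_preemption :: "request list \<Rightarrow> node list list \<Rightarrow> bool" where
  "no_preemption \<sigma> ws \<longleftrightarrow> (\<forall>i<length \<sigma>. ws ! i = [src (\<sigma> ! i)] \<or> last (ws ! i) = dst (\<sigma> ! i))"

text \<open>A deterministic algorithm maps an input sequence to a schedule.  It is online if
  the positions of every packet up to time \<tau>+1 (i.e. all decisions taken in time steps
  0..\<tau>) depend only on the requests with input time \<le> \<tau>.\<close>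
definition online :: "nat list \<Rightarrow> (request list \<Rightarrow> node list list) \<Rightarrow> bool" where
  "online ls ALG \<longleftrightarrow> (\<forall>\<sigma> \<sigma>' \<tau>. valid_input ls \<sigma> \<and> valid_input ls \<sigma>' \<and>
      takeWhile (\<lambda>r. tin r \<le> \<tau>) \<sigma> = takeWhile (\<lambda>r. tin r \<le> \<tau>) \<sigma>' \<longrightarrow>
      (\<forall>i < length (takeWhile (\<lambda>r. tin r \<le> \<tau>) \<sigma>).
         take (Suc (Suc \<tau>) - tin (\<sigma> ! i)) (ALG \<sigma> ! i) =
         take (Suc (Suc \<tau>) - tin (\<sigma> ! i)) (ALG \<sigma>' ! i)))"

definition competitive :: "nat list \<Rightarrow> nat \<Rightarrow> nat \<Rightarrow> (request list \<Rightarrow> node list list) \<Rightarrow> real \<Rightarrow> bool" where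
  "competitive ls c B ALG \<rho> \<longleftrightarrow> (\<forall>\<sigma>. valid_input ls \<sigma> \<longrightarrow>
      feasible (grid_E ls) c B \<sigma> (ALG \<sigma>) \<and>
      real (OPT (grid_E ls) c B \<sigma>) \<le> \<rho> * real (throughput \<sigma> (ALG \<sigma>)))"

definition nu_par :: "nat list \<Rightarrow> nat \<Rightarrow> nat \<Rightarrow> real" where
  "nu_par ls B c = 2 * real (grid_n ls) * (real (length ls) + real B / real c)"

definition pmax_par :: "nat list \<Rightarrow> nat \<Rightarrow> nat \<Rightarrow> real" where
  "pmax_par ls B c = (nu_par ls B c + 2) * real (diam (grid_V ls) (grid_E ls))"

definition k_par :: "nat list \<Rightarrow> nat \<Rightarrow> nat \<Rightarrow> int" where
  "k_par ls B c = \<lceil>log 2 (1 + 3 * pmax_par ls B c)\<rceil>"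

end

theory Submission
  imports Defs "HOL-Analysis.Convex"
begin

text \<open>
  The algorithm packs paths online in the space-time graph. An edge with load \<open>l\<close> and capacity
  \<open>cap\<close> has the price \<open>(2 powr (k * l / cap) - 1) / P\<close>, and a request is accepted
  iff some admissible path of at most \<open>P\<close> steps costs less than 1. Since \<open>1 + 3 P \<le> 2 ^ k\<close> and
  \<open>k \<le> cap\<close>, no edge is ever overloaded, and each accepted request increases the potential
  \<open>\<Sum> cap * price\<close> by at most \<open>2 k\<close>.

  A packet that the optimum delivers within \<open>P\<close> steps and the algorithm rejects has an optimal path
  of cost at least 1. If the optimum needs more than \<open>P\<close> steps, the packet could instead follow the
  optimal trajectory for \<open>s\<close> steps and then take a shortest path, for each of \<open>S\<close> values of \<open>s\<close>;
  each of these paths costs at least 1. At any time the optimum has at most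
  \<open>card V * B + card E * c\<close> packets under way, so averaging over \<open>s\<close> turns the shortest-path parts
  into an additional load of at most \<open>diam * (card V * B + card E * c) / S \<le> c\<close> on every link.
  Hence the packets delivered by the optimum but rejected number at most twice the potential.
\<close>

section \<open>Trajectories as sets of space-time edges\<close>

definition walk_edges :: "nat \<Rightarrow> node list \<Rightarrow> (nat \<times> node \<times> node) set" where
  "walk_edges t q = (\<lambda>j. (t + j, q ! j, q ! Suc j)) ` {j. Suc j < length q}"

lemma finite_walk_edges [simp]: "finite (walk_edges t q)"
proof -
  have "{j. Suc j < length q} \<subseteq> {..<length q}" by auto
  then show ?thesis unfolding walk_edges_def by (meson finite_imageI finite_lessThan finite_subset)
qed

text \<open>The time coordinate grows with every step, so a walk uses no space-time edge twice, even
  while it waits at a node.\<close>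

lemma card_walk_edges: "card (walk_edges t q) = length q - 1"
proof -
  have "inj_on (\<lambda>j. (t + j, q ! j, q ! Suc j)) {j. Suc j < length q}"
    by (auto intro: inj_onI)
  moreover have "{j. Suc j < length q} = {..<length q - 1}" by auto
  ultimately show ?thesis unfolding walk_edges_def by (simp add: card_image)
qed

lemma walk_edges_singleton [simp]: "walk_edges t [x] = {}"
  by (simp add: walk_edges_def)

lemma mem_walk_edges:
  "(\<tau>, u, v) \<in> walk_edges t q \<longleftrightarrow> t \<le> \<tau> \<and> Suc (\<tau> - t) < length q \<and> q ! (\<tau> - t) = u \<and> q ! Suc (\<tau> - t) = v"
  unfolding walk_edges_def by (auto intro!: image_eqI[where x = "\<tau> - t"])

text \<open>The only step that crosses the seam ends at \<open>hd p\<close>, which is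
  \<open>w ! s\<close>; it is therefore still a step of \<open>w\<close>.\<close>

lemma walk_edges_splice:
  assumes "s < length w" "p \<noteq> []" "hd p = w ! s"
  shows "walk_edges t (take s w @ p) \<subseteq> walk_edges t w \<union> walk_edges (t + s) p"
proof
  fix e assume "e \<in> walk_edges t (take s w @ p)"
  then obtain j where j: "Suc j < s + length p" "e = (t + j, (take s w @ p) ! j, (take s w @ p) ! Suc j)"
    using assms(1) unfolding walk_edges_def by auto
  have p0: "p ! 0 = w ! s" using assms by (simp add: hd_conv_nth)
  consider "Suc j < s" | "Suc j = s" | "s \<le> j" by linarith
  then show "e \<in> walk_edges t w \<union> walk_edges (t + s) p"
  proof cases
    case 1
    then have "e = (t + j, w ! j, w ! Suc j)" using j assms(1) by (simp add: nth_append)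
    then show ?thesis using 1 assms(1) unfolding walk_edges_def by auto
  next
    case 2
    then have "e = (t + j, w ! j, w ! Suc j)" using j assms(1) p0 by (auto simp: nth_append)
    then show ?thesis using 2 assms(1) unfolding walk_edges_def by auto
  next
    case 3
    then have "e = (t + s + (j - s), p ! (j - s), p ! Suc (j - s))"
      using j assms(1) by (simp add: nth_append Suc_diff_le)
    moreover have "Suc (j - s) < length p" using 3 j by linarith
    ultimately show ?thesis unfolding walk_edges_def by auto
  qed
qed

lemma steps_eq:
  "steps \<sigma> ws \<tau> u v = {i. i < length \<sigma> \<and> (\<tau>, u, v) \<in> walk_edges (tin (\<sigma> ! i)) (ws ! i)}"
  unfolding steps_def by (auto simp: mem_walk_edges)

definition delivers :: "request \<Rightarrow> node list \<Rightarrow> bool" where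
  "delivers r q \<longleftrightarrow> last q = dst r \<and> enat (tin r + length q - 1) \<le> dl r"

lemma throughput_eq:
  "throughput \<sigma> ws = (\<Sum>i<length \<sigma>. of_bool (delivers (\<sigma> ! i) (ws ! i)))"
proof -
  have "delivered_in_time \<sigma> ws = {..<length \<sigma>} \<inter> {i. delivers (\<sigma> ! i) (ws ! i)}"
    by (auto simp: delivered_in_time_def delivers_def)
  then show ?thesis by (simp add: throughput_def sum_of_bool_eq)
qed

lemma card_steps_eq:
  "card (steps \<sigma> ws \<tau> u v) =
    (\<Sum>i<length \<sigma>. of_bool ((\<tau>, u, v) \<in> walk_edges (tin (\<sigma> ! i)) (ws ! i)))"
proof -
  have "steps \<sigma> ws \<tau> u v
      = {..<length \<sigma>} \<inter> {i. (\<tau>, u, v) \<in> walk_edges (tin (\<sigma> ! i)) (ws ! i)}"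
    by (auto simp: steps_eq)
  then show ?thesis by (simp add: sum_of_bool_eq)
qed

text \<open>The start time \<open>t\<close> is arbitrary because the condition only looks at the two
  nodes of each step.\<close>

lemma valid_traj_alt:
  "valid_traj E r q \<longleftrightarrow> q \<noteq> [] \<and> hd q = src r \<and> dst r \<notin> set (butlast q) \<and>
    (\<forall>(\<tau>, u, v)\<in>walk_edges t q. (u, v) \<in> E \<or> u = v)"
  unfolding valid_traj_def walk_edges_def by auto

lemma path_walk_edges: "is_path E p \<Longrightarrow> (\<tau>, u, v) \<in> walk_edges t p \<Longrightarrow> (u, v) \<in> E"
  by (auto simp: is_path_def walk_edges_def)

section \<open>Reachability, shortest paths and double counting\<close>

lemma lazy_walk_reachable:
  assumes "w \<noteq> []" "\<And>i. Suc i < length w \<Longrightarrow> (w ! i, w ! Suc i) \<in> E \<or> w ! i = w ! Suc i"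
  shows "reachable E (hd w) (last w)"
  using assms
proof (induction w)
  case (Cons x w)
  show ?case
  proof (cases "w = []")
    case True
    then show ?thesis unfolding reachable_def is_path_def by (auto intro!: exI[of _ "[x]"])
  next
    case False
    have st: "(w ! i, w ! Suc i) \<in> E \<or> w ! i = w ! Suc i" if "Suc i < length w" for i
      using Cons.prems(2)[of "Suc i"] that by simp
    then obtain p where p: "is_path E p" "hd p = hd w" "last p = last w"
      using Cons.IH[OF False st] unfolding reachable_def by auto
    \<comment> \<open>A waiting step \<open>x = hd w\<close> is dropped; a real one is put in front
      of the path \<open>p\<close>.\<close>
    have "(x, hd w) \<in> E \<or> x = hd w" using Cons.prems(2)[of 0] False by (auto simp: hd_conv_nth)
    moreover have "is_path E (x # p)" if "(x, hd w) \<in> E"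
      using p that unfolding is_path_def by (auto simp: nth_Cons hd_conv_nth split: nat.split)
    ultimately show ?thesis
      using p False unfolding reachable_def
      by (metis is_path_def last_ConsR list.sel(1))
  qed
qed simp

lemma valid_traj_reachable:
  assumes "valid_traj E r q" "s < length q"
  shows "reachable E (src r) (q ! s)" "reachable E (q ! s) (last q)"
proof -
  have "reachable E (hd (take (Suc s) q)) (last (take (Suc s) q))"
    using assms by (intro lazy_walk_reachable) (auto simp: valid_traj_def)
  then show "reachable E (src r) (q ! s)"
    using assms by (simp add: valid_traj_def take_Suc_conv_app_nth hd_append hd_conv_nth split: if_splits)
  have "reachable E (hd (drop s q)) (last (drop s q))"
    using assms by (intro lazy_walk_reachable) (auto simp: valid_traj_def)
  then show "reachable E (q ! s) (last q)"
    using assms by (simp add: hd_drop_conv_nth)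
qed

lemma reachable_mem:
  assumes "reachable E u v" "u \<in> V" "E \<subseteq> V \<times> V"
  shows "v \<in> V"
proof -
  obtain p where p: "is_path E p" "hd p = u" "last p = v" using assms(1) by (auto simp: reachable_def)
  show ?thesis
  proof (cases "length p \<le> 1")
    case True
    then show ?thesis using p assms(2) by (cases p) (auto simp: is_path_def)
  next
    case False
    then have "Suc (length p - 2) < length p" "Suc (length p - 2) = length p - 1" by auto
    moreover have "p \<noteq> []" using p(1) by (simp add: is_path_def)
    ultimately show ?thesis using p(1,3) assms(3) unfolding is_path_def last_conv_nth[OF \<open>p \<noteq> []\<close>]
      by (metis SigmaD2 subsetD)
  qed
qed

text \<open>Double counting: the total cost of a family of walks becomes load times price, summed
  over the edges.\<close>

lemma sum_incidence:
  fixes X :: "'b \<Rightarrow> real"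
  assumes "finite I" "finite F" "\<And>i. i \<in> I \<Longrightarrow> A i \<subseteq> F"
  shows "(\<Sum>i\<in>I. \<Sum>e\<in>A i. X e) = (\<Sum>e\<in>F. card {i \<in> I. e \<in> A i} * X e)"
proof -
  have "(\<Sum>e\<in>A i. X e) = (\<Sum>e | e \<in> F \<and> e \<in> A i. X e)" if "i \<in> I" for i
    using assms(3)[OF that] by (intro sum.cong) auto
  then have "(\<Sum>i\<in>I. \<Sum>e\<in>A i. X e) = (\<Sum>i\<in>I. \<Sum>e | e \<in> F \<and> e \<in> A i. X e)" by simp
  also have "\<dots> = (\<Sum>e\<in>F. \<Sum>i | i \<in> I \<and> e \<in> A i. X e)"
    using assms(1,2) by (rule sum.swap_restrict)
  finally show ?thesis by simp
qed

text \<open>A path that met \<open>v\<close> earlier could be cut there, against the minimality of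
  \<open>gdist\<close>. The last conjunct matches \<open>valid_traj\<close>, where the destination
  may only be the last entry.\<close>

lemma shortest_path_exists:
  assumes "reachable E u v"
  shows "\<exists>p. is_path E p \<and> hd p = u \<and> last p = v \<and> length p = Suc (gdist E u v) \<and> v \<notin> set (butlast p)"
proof -
  let ?Q = "\<lambda>m. \<exists>p. is_path E p \<and> hd p = u \<and> last p = v \<and> length p = Suc m"
  obtain p0 where p0: "is_path E p0" "hd p0 = u" "last p0 = v"
    using assms unfolding reachable_def by auto
  then have "?Q (length p0 - 1)" unfolding is_path_def by auto
  then have "?Q (gdist E u v)" unfolding gdist_def by (rule LeastI)
  then obtain p where p: "is_path E p" "hd p = u" "last p = v" "length p = Suc (gdist E u v)" by auto
  have "v \<notin> set (butlast p)"
  proof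
    assume "v \<in> set (butlast p)"
    then obtain j where j: "j < length p - 1" "p ! j = v" by (auto simp: in_set_conv_nth nth_butlast)
    let ?q = "take (Suc j) p"
    have "is_path E ?q" using p(1) j unfolding is_path_def by auto
    moreover have "hd ?q = u" using p by simp
    moreover have "last ?q = v" using j by (simp add: take_Suc_conv_app_nth)
    moreover have "length ?q = Suc j" using j by simp
    ultimately have "?Q j" by blast
    then have "gdist E u v \<le> j" unfolding gdist_def by (rule Least_le)
    then show False using j p(4) by simp
  qed
  then show ?thesis using p by blast
qed

lemma gdist_le_diam:
  assumes "finite V" "u \<in> V" "v \<in> V" "reachable E u v"
  shows "gdist E u v \<le> diam V E"
proof -
  have "finite {gdist E u v | u v. u \<in> V \<and> v \<in> V \<and> reachable E u v}"
    by (rule finite_subset[of _ "(\<lambda>(u, v). gdist E u v) ` (V \<times> V)"]) (use assms(1) in auto)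
  then show ?thesis unfolding diam_def using assms by (intro Max_ge) auto
qed

text \<open>The schedule \<open>ws0\<close> makes the set under \<open>Max\<close> nonempty and the
  number of requests bounds it, so some schedule attains the maximum.\<close>

lemma OPT_le:
  assumes "feasible E c B \<sigma> ws0" "\<And>ws. feasible E c B \<sigma> ws \<Longrightarrow> real (throughput \<sigma> ws) \<le> b"
  shows "real (OPT E c B \<sigma>) \<le> b"
proof -
  let ?A = "{throughput \<sigma> ws | ws. feasible E c B \<sigma> ws}"
  have "throughput \<sigma> ws \<le> length \<sigma>" for ws
    unfolding throughput_eq by (rule order_trans[OF sum_mono[where g = "\<lambda>_. 1"]]) auto
  then have "finite ?A" by (auto intro: finite_subset[of _ "{..length \<sigma>}"])
  then have "Max ?A \<in> ?A" using assms(1) by (intro Max_in) auto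
  then show ?thesis unfolding OPT_def using assms(2) by auto
qed

section \<open>The online algorithm: prices, potential and capacities\<close>

locale network =
  fixes V :: "node set" and E :: "(node \<times> node) set" and c B k :: nat and P :: real
  assumes finite_V: "finite V" and E_V: "E \<subseteq> V \<times> V" and E_irrefl: "(v, v) \<notin> E"
    and k_pos: "1 \<le> k" and k_le_c: "k \<le> c" and k_le_B: "k \<le> B"
    and P_ge: "1 \<le> P" and P_le: "1 + 3 * P \<le> 2 ^ k"
begin

text \<open>A self-loop stands for storage at a node, any other pair for a link;
  \<open>E_irrefl\<close> keeps the two apart.\<close>

definition cap :: "nat \<times> node \<times> node \<Rightarrow> nat" where
  "cap = (\<lambda>(\<tau>, u, v). if u = v then B else c)"

text \<open>An unloaded edge is free, and by \<open>P_le\<close> a full one costs at least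
  3.\<close>

definition price :: "(nat \<times> node \<times> node \<Rightarrow> nat) \<Rightarrow> nat \<times> node \<times> node \<Rightarrow> real" where
  "price l e = (2 powr (k * l e / cap e) - 1) / P"

definition admissible :: "request \<Rightarrow> node list \<Rightarrow> bool" where
  "admissible r q \<longleftrightarrow> valid_traj E r q \<and> delivers r q \<and> real (length q - 1) \<le> P"

definition cheap :: "(nat \<times> node \<times> node \<Rightarrow> nat) \<Rightarrow> request \<Rightarrow> node list \<Rightarrow> bool" where
  "cheap l r q \<longleftrightarrow> admissible r q \<and> (\<Sum>e\<in>walk_edges (tin r) q. price l e) < 1"

text \<open>The one-node walk encodes rejection; it has no edges and leaves all loads
  unchanged.\<close>

definition pick :: "(nat \<times> node \<times> node \<Rightarrow> nat) \<Rightarrow> request \<Rightarrow> node list" where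
  "pick l r = (if \<exists>q. cheap l r q then SOME q. cheap l r q else [src r])"

definition add_load :: "(nat \<times> node \<times> node \<Rightarrow> nat) \<Rightarrow> request \<Rightarrow> node list \<Rightarrow> nat \<times> node \<times> node \<Rightarrow> nat" where
  "add_load l r q e = l e + of_bool (e \<in> walk_edges (tin r) q)"

fun run :: "(nat \<times> node \<times> node \<Rightarrow> nat) \<Rightarrow> request list \<Rightarrow> node list list" where
  "run l [] = []"
| "run l (r # rs) = pick l r # run (add_load l r (pick l r)) rs"

fun final :: "(nat \<times> node \<times> node \<Rightarrow> nat) \<Rightarrow> request list \<Rightarrow> nat \<times> node \<times> node \<Rightarrow> nat" where
  "final l [] = l"
| "final l (r # rs) = final (add_load l r (pick l r)) rs"

lemma cap_ge: "k \<le> cap e"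
  using k_le_c k_le_B by (auto simp: cap_def split: prod.split)

lemma price_nonneg: "0 \<le> price l e"
proof -
  have "1 \<le> (2::real) powr (k * l e / cap e)" by (rule ge_one_powr_ge_zero) auto
  then show ?thesis using P_ge by (simp add: price_def)
qed

lemma price_mono: "l e \<le> l' e \<Longrightarrow> price l e \<le> price l' e"
  using P_ge by (auto simp: price_def intro!: divide_right_mono powr_mono mult_left_mono)

lemma final_ge: "l e \<le> final l rs e"
proof (induction rs arbitrary: l)
  case (Cons r rs)
  have "l e \<le> add_load l r (pick l r) e" by (simp add: add_load_def)
  also have "\<dots> \<le> final (add_load l r (pick l r)) rs e" by (rule Cons.IH)
  finally show ?case by simp
qed simp

lemma length_run [simp]: "length (run l rs) = length rs"
  by (induction rs arbitrary: l) auto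

lemma run_append: "run l (xs @ ys) = run l xs @ run (final l xs) ys"
  by (induction xs arbitrary: l) auto

lemma final_eq:
  "final l rs e = l e + (\<Sum>i<length rs. of_bool (e \<in> walk_edges (tin (rs ! i)) (run l rs ! i)))"
  by (induction rs arbitrary: l)
     (simp_all add: add_load_def sum.lessThan_Suc_shift del: sum.lessThan_Suc)

lemma pick_cases:
  obtains "cheap l r (pick l r)" | "pick l r = [src r]" "\<And>q. \<not> cheap l r q"
  by (metis pick_def someI)

lemma valid_traj_pick: "valid_traj E r (pick l r)"
  by (cases rule: pick_cases[of l r]) (auto simp: cheap_def admissible_def valid_traj_def)

text \<open>\<open>l'\<close> is the load on arrival of request \<open>i\<close>; later acceptances
  can only add to it.\<close>

lemma run_nth_pick: "i < length rs \<Longrightarrow> \<exists>l'. run l rs ! i = pick l' (rs ! i) \<and> (\<forall>e. l' e \<le> final l rs e)"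
proof (induction rs arbitrary: l i)
  case (Cons r rs)
  show ?case
  proof (cases i)
    case 0
    then show ?thesis using final_ge[of l _ "r # rs"] by (auto simp del: final.simps)
  next
    case (Suc j)
    then show ?thesis using Cons.IH[of j "add_load l r (pick l r)"] Cons.prems by auto
  qed
qed simp

text \<open>No walk was cheap when the request arrived, and prices have only risen since
  then.\<close>

lemma rejected_expensive:
  assumes "i < length rs" "\<not> delivers (rs ! i) (run l rs ! i)" "admissible (rs ! i) q"
  shows "1 \<le> (\<Sum>e\<in>walk_edges (tin (rs ! i)) q. price (final l rs) e)"
proof -
  obtain l' where l': "run l rs ! i = pick l' (rs ! i)" "\<And>e. l' e \<le> final l rs e"
    using run_nth_pick[OF assms(1)] by blast
  have "\<not> cheap l' (rs ! i) q"
    using assms(2) l'(1) by (cases rule: pick_cases[of l' "rs ! i"]) (auto simp: cheap_def admissible_def)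
  then have "1 \<le> (\<Sum>e\<in>walk_edges (tin (rs ! i)) q. price l' e)"
    using assms(3) by (auto simp: cheap_def)
  also have "\<dots> \<le> (\<Sum>e\<in>walk_edges (tin (rs ! i)) q. price (final l rs) e)"
    by (intro sum_mono price_mono l'(2))
  finally show ?thesis .
qed

text \<open>By convexity, \<open>2 powr y\<close> lies below its chord between the points 0 and
  1.\<close>

lemma two_powr_le:
  assumes "0 \<le> y" "y \<le> 1"
  shows "2 powr y \<le> 1 + (y::real)"
proof -
  have "exp ((1 - y) *\<^sub>R 0 + y *\<^sub>R ln 2) \<le> (1 - y) * exp 0 + y * exp (ln (2::real))"
    using assms by (intro convex_onD[OF exp_convex]) auto
  then show ?thesis by (simp add: powr_def)
qed

text \<open>One more unit of load multiplies \<open>z = P * price l e + 1\<close> by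
  \<open>2 powr y \<le> 1 + y\<close>, where \<open>y = k / cap e \<le> 1\<close>. The weight
  \<open>cap e\<close> turns \<open>y\<close> into \<open>k\<close>, so the bound on the increase is
  free of the capacity.\<close>

lemma price_add_load:
  assumes "e \<in> walk_edges (tin r) q"
  shows "cap e * price (add_load l r q) e \<le> cap e * price l e + k * (price l e + 1 / P)"
proof -
  define y z where "y = real k / cap e" and "z = 2 powr (k * l e / cap e)"
  have cap: "real (cap e) > 0" using cap_ge[of e] k_pos by simp
  have y: "0 \<le> y" "y \<le> 1" "cap e * y = k" using cap_ge[of e] cap by (auto simp: y_def)
  have z: "z \<ge> 0" by (simp add: z_def)
  have "2 powr (k * add_load l r q e / cap e) = z * 2 powr y"
    using assms by (simp add: z_def y_def add_load_def powr_add[symmetric] algebra_simps add_divide_distrib)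
  also have "\<dots> \<le> z * (1 + y)" using two_powr_le[OF y(1,2)] z by (rule mult_left_mono)
  finally have "price (add_load l r q) e \<le> (z * (1 + y) - 1) / P"
    using P_ge by (auto simp: price_def intro!: divide_right_mono)
  also have "\<dots> = price l e + y * (price l e + 1 / P)"
    using P_ge by (simp add: price_def z_def field_simps)
  finally have "cap e * price (add_load l r q) e \<le> cap e * (price l e + y * (price l e + 1 / P))"
    using cap by (intro mult_left_mono) auto
  also have "\<dots> = cap e * price l e + (cap e * y) * (price l e + 1 / P)" by (simp add: algebra_simps)
  finally show ?thesis using y(3) by simp
qed

lemma price_add_load_other:
  assumes "e \<notin> walk_edges (tin r) q"
  shows "price (add_load l r q) e = price l e"
  using assms by (simp add: price_def add_load_def)

text \<open>A cheap walk has total price below 1 and at most \<open>P\<close> edges, each adding a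
  further \<open>1 / P\<close>, so the increases sum to at most \<open>k * (1 + 1)\<close>.\<close>

lemma potential_pick:
  assumes "finite F"
  shows "(\<Sum>e\<in>F. cap e * price (add_load l r (pick l r)) e)
    \<le> (\<Sum>e\<in>F. cap e * price l e) + 2 * k * of_bool (delivers r (pick l r))"
proof (cases rule: pick_cases[of l r])
  case 1
  let ?q = "pick l r" and ?W = "walk_edges (tin r) (pick l r)"
  let ?g = "\<lambda>e. k * (price l e + 1 / P)"
  have g: "0 \<le> ?g e" for e using price_nonneg[of l e] P_ge by simp
  have "(\<Sum>e\<in>F. cap e * price (add_load l r ?q) e)
      \<le> (\<Sum>e\<in>F. cap e * price l e + (if e \<in> ?W then ?g e else 0))"
    using price_add_load[of _ r ?q l] by (intro sum_mono) (auto simp: price_add_load_other)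
  also have "\<dots> = (\<Sum>e\<in>F. cap e * price l e) + (\<Sum>e\<in>F \<inter> ?W. ?g e)"
    using assms by (simp add: sum.distrib sum.inter_restrict)
  also have "(\<Sum>e\<in>F \<inter> ?W. ?g e) \<le> (\<Sum>e\<in>?W. ?g e)"
    using g by (intro sum_mono2) auto
  also have "(\<Sum>e\<in>?W. ?g e) = k * ((\<Sum>e\<in>?W. price l e) + card ?W / P)"
    by (simp add: sum.distrib flip: sum_distrib_left)
  also have "\<dots> \<le> real k * (1 + 1)"
    using 1 P_ge unfolding cheap_def admissible_def card_walk_edges
    by (intro mult_left_mono add_mono) auto
  finally show ?thesis using 1 by (simp add: cheap_def admissible_def)
next
  case 2
  then show ?thesis using k_pos by (simp add: price_def add_load_def)
qed

lemma potential_final: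
  assumes "finite F"
  shows "(\<Sum>e\<in>F. cap e * price (final l rs) e)
    \<le> (\<Sum>e\<in>F. cap e * price l e) + 2 * k * real (throughput rs (run l rs))"
proof (induction rs arbitrary: l)
  case (Cons r rs)
  let ?q = "pick l r"
  have "real (throughput (r # rs) (run l (r # rs)))
    = of_bool (delivers r ?q) + real (throughput rs (run (add_load l r ?q) rs))"
    by (simp add: throughput_eq sum.lessThan_Suc_shift del: sum.lessThan_Suc)
  then show ?case
    using Cons.IH[of "add_load l r ?q"] potential_pick[OF assms, of l r] by (simp add: algebra_simps)
qed (simp add: throughput_eq)

text \<open>On a cheap walk \<open>2 powr (k * l e / cap e) < 1 + P\<close>. One more unit at most
  doubles this power because \<open>k \<le> cap e\<close>, and
  \<open>2 * (1 + P) \<le> 1 + 3 * P \<le> 2 ^ k\<close>, so the new exponent is at most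
  \<open>k\<close>.\<close>

lemma load_bound_pick:
  assumes "l e \<le> cap e"
  shows "add_load l r (pick l r) e \<le> cap e"
proof (cases rule: pick_cases[of l r])
  case 1
  show ?thesis
  proof (cases "e \<in> walk_edges (tin r) (pick l r)")
    case True
    have cap: "real (cap e) > 0" using cap_ge[of e] k_pos by simp
    have "price l e \<le> (\<Sum>e\<in>walk_edges (tin r) (pick l r). price l e)"
      using True by (intro member_le_sum price_nonneg) auto
    also have "\<dots> < 1" using 1 by (simp add: cheap_def)
    finally have z: "2 powr (k * l e / cap e) < 1 + P" using P_ge by (simp add: price_def field_simps)
    have "k / cap e \<le> (1::real)" using cap_ge[of e] cap by simp
    then have "2 powr (k / cap e) \<le> (2::real) powr 1" by (intro powr_mono) auto
    then have "2 powr (k * l e / cap e) * 2 powr (k / cap e) \<le> (1 + P) * 2"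
      using z P_ge by (intro mult_mono) auto
    also have "\<dots> \<le> 2 powr k" using P_le P_ge by (simp add: powr_realpow)
    finally have "2 powr (k * (l e + 1) / cap e) \<le> (2::real) powr k"
      by (simp add: powr_add[symmetric] algebra_simps add_divide_distrib)
    then have "k * (l e + 1) / cap e \<le> real k" by simp
    then have "real k * real (l e + 1) \<le> real k * real (cap e)" using cap by (simp add: field_simps)
    then have "real (l e + 1) \<le> real (cap e)" using k_pos by (subst (asm) mult_le_cancel_left_pos) auto
    then have "l e + 1 \<le> cap e" by (simp only: of_nat_le_iff)
    then show ?thesis using True by (simp add: add_load_def)
  qed (use assms in \<open>simp add: add_load_def\<close>)
qed (use assms in \<open>simp add: add_load_def\<close>)

lemma load_bound_final: "(\<And>e. l e \<le> cap e) \<Longrightarrow> final l rs e \<le> cap e"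
proof (induction rs arbitrary: l)
  case (Cons r rs)
  show ?case unfolding final.simps by (intro Cons.IH load_bound_pick Cons.prems)
qed simp

definition alg :: "request list \<Rightarrow> node list list" where
  "alg = run (\<lambda>_. 0)"

lemma alg_append: "alg (xs @ ys) ! i = alg xs ! i" if "i < length xs"
  using that by (simp add: alg_def run_append nth_append)

lemma feasible_alg: "feasible E c B \<sigma> (alg \<sigma>)"
proof -
  have "valid_traj E (\<sigma> ! i) (alg \<sigma> ! i)" if "i < length \<sigma>" for i
    using run_nth_pick[OF that] valid_traj_pick unfolding alg_def by metis
  moreover have "card (steps \<sigma> (alg \<sigma>) \<tau> u v) \<le> cap (\<tau>, u, v)" for \<tau> u v
    using load_bound_final[of "\<lambda>_. 0" \<sigma> "(\<tau>, u, v)"]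
    by (simp add: final_eq card_steps_eq alg_def)
  moreover have "cap (\<tau>, u, v) = c" if "(u, v) \<in> E" for \<tau> u v
    using that E_irrefl by (auto simp: cap_def)
  moreover have "cap (\<tau>, v, v) = B" for \<tau> v by (simp add: cap_def)
  ultimately show ?thesis unfolding feasible_def by (metis length_run alg_def)
qed

lemma no_preemption_alg: "no_preemption \<sigma> (alg \<sigma>)"
  unfolding no_preemption_def alg_def
proof (intro allI impI)
  fix i assume "i < length \<sigma>"
  then obtain l where l: "run (\<lambda>_. 0) \<sigma> ! i = pick l (\<sigma> ! i)" using run_nth_pick by blast
  show "run (\<lambda>_. 0) \<sigma> ! i = [src (\<sigma> ! i)] \<or> last (run (\<lambda>_. 0) \<sigma> ! i) = dst (\<sigma> ! i)"
    unfolding l by (cases rule: pick_cases[of l "\<sigma> ! i"]) (auto simp: cheap_def admissible_def delivers_def)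
qed

section \<open>Load and population of an arbitrary feasible schedule\<close>

lemma feasible_load:
  assumes "feasible E c B \<sigma> ws"
  shows "card {i. i < length \<sigma> \<and> e \<in> walk_edges (tin (\<sigma> ! i)) (ws ! i)} \<le> cap e"
proof -
  obtain \<tau> u v where e: "e = (\<tau>, u, v)" by (cases e)
  have *: "{i. i < length \<sigma> \<and> e \<in> walk_edges (tin (\<sigma> ! i)) (ws ! i)} = steps \<sigma> ws \<tau> u v"
    by (simp add: e steps_eq)
  consider "u = v" | "u \<noteq> v" "(u, v) \<in> E" | "u \<noteq> v" "(u, v) \<notin> E" by blast
  then show ?thesis
  proof cases
    \<comment> \<open>No valid trajectory uses a pair that is neither a link nor a self-loop, so the
      bound holds for every triple \<open>e\<close>.\<close>
    case 3
    have "steps \<sigma> ws \<tau> u v = {}"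
      using assms 3 unfolding feasible_def valid_traj_def steps_def by blast
    then show ?thesis by (simp add: *)
  qed (use assms in \<open>unfold * feasible_def, auto simp: cap_def e\<close>)
qed

text \<open>Only packets that still make a step from time \<open>\<tau>\<close> to
  \<open>\<tau> + 1\<close> count; the last entry of a trajectory occupies no capacity.\<close>

definition present :: "request list \<Rightarrow> node list list \<Rightarrow> nat \<Rightarrow> nat set" where
  "present \<sigma> ws \<tau> = {i. i < length \<sigma> \<and> tin (\<sigma> ! i) \<le> \<tau> \<and> Suc (\<tau> - tin (\<sigma> ! i)) < length (ws ! i)}"

text \<open>During one time step each such packet occupies either the buffer of a node or a
  link.\<close>

lemma card_present:
  assumes "feasible E c B \<sigma> ws" "\<And>r. r \<in> set \<sigma> \<Longrightarrow> src r \<in> V"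
  shows "card (present \<sigma> ws \<tau>) \<le> card V * B + card E * c"
proof -
  have fin: "finite E" using finite_V E_V finite_subset by blast
  let ?A = "\<Union>v\<in>V. steps \<sigma> ws \<tau> v v" and ?C = "\<Union>(u, v)\<in>E. steps \<sigma> ws \<tau> u v"
  have "present \<sigma> ws \<tau> \<subseteq> ?A \<union> ?C"
  proof
    fix i assume i: "i \<in> present \<sigma> ws \<tau>"
    define s where "s = \<tau> - tin (\<sigma> ! i)"
    have s: "i < length \<sigma>" "Suc s < length (ws ! i)" using i by (auto simp: present_def s_def)
    have vt: "valid_traj E (\<sigma> ! i) (ws ! i)" using assms(1) s by (auto simp: feasible_def)
    then have "ws ! i ! s \<in> V"
      using valid_traj_reachable(1)[OF vt, of s] s assms(2) E_V by (auto intro: reachable_mem)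
    moreover have "(ws ! i ! s, ws ! i ! Suc s) \<in> E \<or> ws ! i ! s = ws ! i ! Suc s"
      using vt s by (auto simp: valid_traj_def)
    moreover have "i \<in> steps \<sigma> ws \<tau> (ws ! i ! s) (ws ! i ! Suc s)"
      using i by (auto simp: present_def steps_def s_def)
    ultimately show "i \<in> ?A \<union> ?C" by auto
  qed
  moreover have fin_steps: "finite (steps \<sigma> ws \<tau> u v)" for u v by (simp add: steps_def)
  ultimately have "card (present \<sigma> ws \<tau>) \<le> card (?A \<union> ?C)"
    using finite_V fin by (intro card_mono) auto
  also have "\<dots> \<le> card ?A + card ?C" by (rule card_Un_le)
  also have "card ?A \<le> (\<Sum>v\<in>V. card (steps \<sigma> ws \<tau> v v))" by (rule card_UN_le[OF finite_V])
  also have "\<dots> \<le> card V * B"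
    using assms(1) by (intro sum_bounded_above[THEN order_trans]) (auto simp: feasible_def)
  also have "card ?C \<le> (\<Sum>e\<in>E. card (case e of (u, v) \<Rightarrow> steps \<sigma> ws \<tau> u v))" by (rule card_UN_le[OF fin])
  also have "\<dots> \<le> card E * c"
    using assms(1) by (intro sum_bounded_above[THEN order_trans]) (auto simp: feasible_def)
  finally show ?thesis by simp
qed

definition direct :: "node \<Rightarrow> node \<Rightarrow> node list" where
  "direct u v = (SOME p. is_path E p \<and> hd p = u \<and> last p = v \<and> length p = Suc (gdist E u v) \<and> v \<notin> set (butlast p))"

lemma direct:
  assumes "reachable E u v"
  shows "is_path E (direct u v)" "hd (direct u v) = u" "last (direct u v) = v"
    "length (direct u v) = Suc (gdist E u v)" "v \<notin> set (butlast (direct u v))"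
  using someI_ex[OF shortest_path_exists[OF assms]] unfolding direct_def by blast+

section \<open>Averaging over the switching times\<close>

context
  fixes \<sigma> ws S
  assumes feas: "feasible E c B \<sigma> ws" and src_V: "\<And>r. r \<in> set \<sigma> \<Longrightarrow> src r \<in> V"
    and S_pos: "1 \<le> S" and S_le: "real (S + diam V E) \<le> P"
    and S_ge: "diam V E * (card V * B + card E * c) \<le> c * S"
begin

text \<open>Here \<open>s\<close> is a switching time: packet \<open>i\<close>, which needs more
  than \<open>P\<close> steps in \<open>ws\<close>, may leave its trajectory after \<open>s\<close>
  steps for a shortest path.\<close>

definition long :: "nat \<Rightarrow> nat \<Rightarrow> bool" where
  "long i s \<longleftrightarrow> i < length \<sigma> \<and> delivers (\<sigma> ! i) (ws ! i) \<and> P < real (length (ws ! i) - 1) \<and> s < S"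

definition shortcut :: "nat \<Rightarrow> nat \<Rightarrow> node list" where
  "shortcut i s = direct (ws ! i ! s) (dst (\<sigma> ! i))"

lemma long_less: "long i s \<Longrightarrow> s + diam V E + 1 < length (ws ! i)"
  using S_le by (auto simp: long_def)

lemma long_valid: "long i s \<Longrightarrow> valid_traj E (\<sigma> ! i) (ws ! i)"
  using feas by (auto simp: feasible_def long_def)

lemma shortcut:
  assumes "long i s"
  shows "is_path E (shortcut i s)" "hd (shortcut i s) = ws ! i ! s" "last (shortcut i s) = dst (\<sigma> ! i)"
    "length (shortcut i s) \<le> Suc (diam V E)" "dst (\<sigma> ! i) \<notin> set (butlast (shortcut i s))"
proof -
  have s: "s < length (ws ! i)" using long_less[OF assms] by simp
  note reach = valid_traj_reachable[OF long_valid[OF assms] s]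
  have last: "last (ws ! i) = dst (\<sigma> ! i)" using assms by (auto simp: long_def delivers_def)
  have "src (\<sigma> ! i) \<in> V" using assms src_V by (auto simp: long_def)
  then have V1: "ws ! i ! s \<in> V" using reach(1) E_V by (auto intro: reachable_mem)
  then have V2: "dst (\<sigma> ! i) \<in> V" using reach(2) E_V last by (auto intro: reachable_mem)
  have r: "reachable E (ws ! i ! s) (dst (\<sigma> ! i))" using reach(2) last by simp
  show "is_path E (shortcut i s)" "hd (shortcut i s) = ws ! i ! s" "last (shortcut i s) = dst (\<sigma> ! i)"
    "length (shortcut i s) \<le> Suc (diam V E)" "dst (\<sigma> ! i) \<notin> set (butlast (shortcut i s))"
    using direct[OF r] gdist_le_diam[OF finite_V V1 V2 r] by (auto simp: shortcut_def)
qed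

text \<open>The spliced walk ends before \<open>ws ! i\<close> does, by \<open>long_less\<close>,
  which keeps the deadline; it has at most \<open>S + diam V E \<le> P\<close> steps.\<close>

lemma admissible_shortcut:
  assumes "long i s"
  shows "admissible (\<sigma> ! i) (take s (ws ! i) @ shortcut i s)"
proof -
  let ?q = "take s (ws ! i) @ shortcut i s"
  note sc = shortcut[OF assms]
  note vt = long_valid[OF assms, unfolded valid_traj_alt[where t = 0]]
  have s: "s < length (ws ! i)" using long_less[OF assms] by simp
  have ne: "shortcut i s \<noteq> []" using sc(1) by (simp add: is_path_def)
  have "hd ?q = src (\<sigma> ! i)" using vt sc(2) s by (cases "s = 0") (auto simp: hd_append hd_conv_nth)
  \<comment> \<open>The first \<open>s\<close> entries of \<open>ws ! i\<close> lie in
    \<open>butlast (ws ! i)\<close> and so miss the destination.\<close>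
  moreover have "dst (\<sigma> ! i) \<notin> set (butlast ?q)"
    using vt sc(5) ne set_take_subset[of s "butlast (ws ! i)"] s by (auto simp: butlast_append take_butlast)
  moreover have "\<forall>(\<tau>, u, v)\<in>walk_edges 0 ?q. (u, v) \<in> E \<or> u = v"
    using walk_edges_splice[OF s ne sc(2), of 0] vt path_walk_edges[OF sc(1)] by fast
  ultimately have "valid_traj E (\<sigma> ! i) ?q"
    using ne unfolding valid_traj_alt[where t = 0] by simp
  moreover have len: "length ?q \<le> s + Suc (diam V E)" using sc(4) s by simp
  have "delivers (\<sigma> ! i) ?q"
  proof -
    have "enat (tin (\<sigma> ! i) + length ?q - 1) \<le> enat (tin (\<sigma> ! i) + length (ws ! i) - 1)"
      using len long_less[OF assms] by simp
    also have "\<dots> \<le> dl (\<sigma> ! i)" using assms by (simp add: long_def delivers_def)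
    finally show ?thesis using sc(3) ne by (simp add: delivers_def)
  qed
  moreover have "length ?q - 1 \<le> S + diam V E" using len assms unfolding long_def by linarith
  then have "real (length ?q - 1) \<le> P" using S_le by linarith
  ultimately show ?thesis by (simp add: admissible_def)
qed

definition shortcut_edges :: "nat \<times> nat \<Rightarrow> (nat \<times> node \<times> node) set" where
  "shortcut_edges = (\<lambda>(i, s). walk_edges (tin (\<sigma> ! i) + s) (shortcut i s))"

text \<open>A shortcut has at most \<open>diam V E\<close> steps, so one that uses \<open>e\<close>
  at time \<open>\<tau>\<close> began within the last \<open>diam V E\<close> time steps, and its
  packet was under way in \<open>ws\<close> at that moment. Start time and packet determine
  \<open>s\<close>, so \<open>card_present\<close> and \<open>S_ge\<close> bound the number of such
  pairs by \<open>c * S\<close>.\<close>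

lemma card_shortcuts:
  assumes "Q \<subseteq> {(i, s). long i s}"
  shows "card {q \<in> Q. e \<in> shortcut_edges q} \<le> S * cap e"
proof (cases "{q \<in> Q. e \<in> shortcut_edges q} = {}")
  case False
  obtain \<tau> u v where e: "e = (\<tau>, u, v)" by (cases e)
  let ?Z = "{q \<in> Q. e \<in> shortcut_edges q}" and ?D = "diam V E"
  let ?f = "\<lambda>(i, s). (tin (\<sigma> ! i) + s, i)"
  let ?T = "Sigma {\<tau> + 1 - ?D..\<tau>} (present \<sigma> ws)"
  \<comment> \<open>Shortcuts never wait, so only the link capacity matters here.\<close>
  have "(u, v) \<in> E"
    using False assms e path_walk_edges[OF shortcut(1)] by (fastforce simp: shortcut_edges_def)
  then have cap: "cap e = c" using e E_irrefl by (auto simp: cap_def)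
  have "inj_on ?f ?Z" by (auto intro!: inj_onI)
  moreover have "?f ` ?Z \<subseteq> ?T"
  proof (clarsimp, intro conjI)
    fix i s assume "(i, s) \<in> Q" and es: "e \<in> shortcut_edges (i, s)"
    then have l: "long i s" using assms by auto
    show "tin (\<sigma> ! i) + s \<le> \<tau>" "Suc \<tau> - ?D \<le> tin (\<sigma> ! i) + s"
      using es shortcut(4)[OF l] by (auto simp: shortcut_edges_def e mem_walk_edges)
    show "i \<in> present \<sigma> ws (tin (\<sigma> ! i) + s)"
      using l long_less[OF l] by (auto simp: present_def long_def)
  qed
  moreover have "finite ?T" by (auto simp: present_def)
  ultimately have "card ?Z \<le> card ?T" by (rule card_inj_on_le)
  also have "\<dots> = (\<Sum>t = \<tau> + 1 - ?D..\<tau>. card (present \<sigma> ws t))"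
    by (simp add: present_def)
  also have "\<dots> \<le> card {\<tau> + 1 - ?D..\<tau>} * (card V * B + card E * c)"
    using sum_bounded_above[of "{\<tau> + 1 - ?D..\<tau>}" "\<lambda>t. card (present \<sigma> ws t)"] card_present[OF feas src_V]
    by simp
  \<comment> \<open>Truncated subtraction near time 0 can only shorten the interval, so it has at
    most \<open>?D\<close> elements.\<close>
  also have "\<dots> \<le> ?D * (card V * B + card E * c)" by (intro mult_right_mono) auto
  finally show ?thesis using S_ge cap by (simp add: mult.commute)
next
  case True
  then show ?thesis by (simp only: card.empty)
qed

lemma throughput_le_alg: "real (throughput \<sigma> ws) \<le> (1 + 4 * k) * real (throughput \<sigma> (alg \<sigma>))"
proof -
  define X where "X = price (final (\<lambda>_. 0) \<sigma>)"
  have X: "0 \<le> X e" for e by (simp add: X_def price_nonneg)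
  define R where "R = {i. i < length \<sigma> \<and> delivers (\<sigma> ! i) (ws ! i) \<and> \<not> delivers (\<sigma> ! i) (alg \<sigma> ! i)}"
  define Q where "Q = {(i, s). i \<in> R \<and> long i s}"
  define T where "T = (\<lambda>i. walk_edges (tin (\<sigma> ! i)) (ws ! i))"
  \<comment> \<open>The potential is summed only over the finitely many space-time edges that occur
    in the comparison.\<close>
  define F where "F = (\<Union>i\<in>R. T i) \<union> (\<Union>q\<in>Q. shortcut_edges q)"
  have fR: "finite R" by (simp add: R_def)
  have fQ: "finite Q" by (rule finite_subset[of _ "R \<times> {..<S}"]) (use fR in \<open>auto simp: Q_def long_def\<close>)
  have fF: "finite F" using fR fQ by (auto simp: F_def T_def shortcut_edges_def)
  let ?\<Phi> = "\<Sum>e\<in>F. cap e * X e"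
  have exp: "1 \<le> (\<Sum>e\<in>walk_edges (tin (\<sigma> ! i)) q. X e)" if "i \<in> R" "admissible (\<sigma> ! i) q" for i q
    using that rejected_expensive[of i \<sigma> "\<lambda>_. 0" q] by (auto simp: R_def X_def alg_def)
  \<comment> \<open>A packet with at most \<open>P\<close> steps contributes the cost of its
    trajectory \<open>S\<close> times; a longer one contributes one spliced walk for each switching
    time.\<close>
  have each: "real S \<le> S * sum X (T i) + (\<Sum>s | s < S \<and> long i s. sum X (shortcut_edges (i, s)))" if i: "i \<in> R" for i
  proof (cases "real (length (ws ! i) - 1) \<le> P")
    case True
    then have "1 \<le> sum X (T i)"
      using i exp[OF i, of "ws ! i"] feas by (auto simp: T_def admissible_def R_def feasible_def)
    then have "real S \<le> S * sum X (T i)" using S_pos by simp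
    then show ?thesis using X by (smt (verit) sum_nonneg)
  next
    case False
    then have long: "long i s" if "s < S" for s using i that by (auto simp: long_def R_def)
    have "1 \<le> sum X (T i) + sum X (shortcut_edges (i, s))" if "s < S" for s
    proof -
      note l = long[OF that]
      have "1 \<le> (\<Sum>e\<in>walk_edges (tin (\<sigma> ! i)) (take s (ws ! i) @ shortcut i s). X e)"
        by (rule exp[OF i admissible_shortcut[OF l]])
      also have "\<dots> \<le> (\<Sum>e\<in>T i \<union> shortcut_edges (i, s). X e)"
        using walk_edges_splice[OF _ _ shortcut(2)[OF l]] long_less[OF l] shortcut(1)[OF l] X
        by (intro sum_mono2) (auto simp: T_def shortcut_edges_def is_path_def)
      also have "\<dots> \<le> sum X (T i) + sum X (shortcut_edges (i, s))"
        using X by (subst sum.union_inter[symmetric]) (auto simp: T_def shortcut_edges_def sum_nonneg)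
      finally show ?thesis .
    qed
    then have "(\<Sum>s<S. 1) \<le> (\<Sum>s<S. sum X (T i) + sum X (shortcut_edges (i, s)))"
      by (intro sum_mono) auto
    moreover have "{s. s < S \<and> long i s} = {..<S}" using long by auto
    ultimately show ?thesis by (simp add: sum.distrib)
  qed
  have "real S * card R = (\<Sum>i\<in>R. real S)" by simp
  also have "\<dots> \<le> (\<Sum>i\<in>R. S * sum X (T i) + (\<Sum>s | s < S \<and> long i s. sum X (shortcut_edges (i, s))))"
    by (intro sum_mono each)
  also have "\<dots> = S * (\<Sum>i\<in>R. sum X (T i)) + (\<Sum>q\<in>Q. sum X (shortcut_edges q))"
  proof -
    have "Q = Sigma R (\<lambda>i. {s. s < S \<and> long i s})" by (auto simp: Q_def long_def)
    then show ?thesis using fR by (simp add: sum.distrib sum_distrib_left sum.Sigma)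
  qed
  also have "(\<Sum>i\<in>R. sum X (T i)) = (\<Sum>e\<in>F. card {i \<in> R. e \<in> T i} * X e)"
    using fR fF by (intro sum_incidence) (auto simp: F_def)
  also have "\<dots> \<le> ?\<Phi>"
  proof (intro sum_mono mult_right_mono X)
    fix e
    have "card {i \<in> R. e \<in> T i} \<le> card {i. i < length \<sigma> \<and> e \<in> T i}"
      by (intro card_mono) (auto simp: R_def)
    then show "real (card {i \<in> R. e \<in> T i}) \<le> real (cap e)"
      using feasible_load[OF feas, of e] by (simp add: T_def)
  qed
  also have "(\<Sum>q\<in>Q. sum X (shortcut_edges q)) = (\<Sum>e\<in>F. card {q \<in> Q. e \<in> shortcut_edges q} * X e)"
    using fQ fF by (intro sum_incidence) (auto simp: F_def)
  also have "\<dots> \<le> (\<Sum>e\<in>F. (S * cap e) * X e)"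
  proof (intro sum_mono mult_right_mono X)
    fix e
    have "Q \<subseteq> {(i, s). long i s}" by (auto simp: Q_def)
    then show "real (card {q \<in> Q. e \<in> shortcut_edges q}) \<le> real (S * cap e)"
      using card_shortcuts of_nat_mono by blast
  qed
  also have "\<dots> = S * ?\<Phi>" by (simp add: sum_distrib_left mult.assoc)
  finally have "S * real (card R) \<le> S * (2 * ?\<Phi>)" by (simp add: mult_left_mono)
  then have "real (card R) \<le> 2 * ?\<Phi>" using S_pos by simp
  \<comment> \<open>Prices vanish at load zero, so the initial potential is 0.\<close>
  also have "?\<Phi> \<le> 2 * k * real (throughput \<sigma> (alg \<sigma>))"
    using potential_final[OF fF, of "\<lambda>_. 0" \<sigma>] by (simp add: X_def alg_def price_def)
  finally have cR: "real (card R) \<le> 4 * k * real (throughput \<sigma> (alg \<sigma>))" by simp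
  \<comment> \<open>A packet delivered by \<open>ws\<close> is in \<open>R\<close> or delivered by
    \<open>alg\<close>; the latter gives the 1 in \<open>1 + 4 * k\<close>.\<close>
  have "throughput \<sigma> ws \<le> (\<Sum>i<length \<sigma>. of_bool (i \<in> R) + of_bool (delivers (\<sigma> ! i) (alg \<sigma> ! i)))"
    unfolding throughput_eq by (intro sum_mono) (auto simp: R_def)
  also have "\<dots> = card R + throughput \<sigma> (alg \<sigma>)"
  proof -
    have "{..<length \<sigma>} \<inter> {i. i \<in> R} = R" by (auto simp: R_def)
    then show ?thesis by (simp add: sum.distrib throughput_eq sum_of_bool_eq)
  qed
  finally show ?thesis using cR by (simp add: algebra_simps flip: of_nat_add)
qed

end

end

section \<open>Size and diameter of the grid\<close>

lemma grid_V_Cons: "grid_V (l # ls) \<subseteq> (\<lambda>(a, x). a # x) ` ({..<l} \<times> grid_V ls)"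
proof
  fix y assume y: "y \<in> grid_V (l # ls)"
  then obtain a x where ax: "y = a # x" by (cases y) (auto simp: grid_V_def)
  then have "a < l" "x \<in> grid_V ls" using y by (auto simp: grid_V_def simp flip: length_Cons)
  then show "y \<in> (\<lambda>(a, x). a # x) ` ({..<l} \<times> grid_V ls)" using ax by auto
qed

lemma card_grid_V: "finite (grid_V ls) \<and> card (grid_V ls) \<le> grid_n ls"
proof (induction ls)
  case Nil
  have "grid_V [] = {[]}" by (auto simp: grid_V_def)
  then show ?case by (simp add: grid_n_def)
next
  case (Cons l ls)
  let ?A = "{..<l} \<times> grid_V ls"
  have fin: "finite ?A" using Cons by simp
  have "card (grid_V (l # ls)) \<le> card ?A"
    using card_mono[OF finite_imageI[OF fin] grid_V_Cons] card_image_le[OF fin] by (rule order_trans)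
  also have "\<dots> \<le> grid_n (l # ls)" using Cons by (simp add: card_cartesian_product grid_n_def)
  finally show ?case using grid_V_Cons fin by (meson finite_imageI finite_subset)
qed

lemma card_grid_E: "card (grid_E ls) \<le> card (grid_V ls) * length ls"
proof -
  let ?f = "\<lambda>(x :: node, j). (x, x[j := Suc (x ! j)])" and ?A = "grid_V ls \<times> {..<length ls}"
  have fin: "finite ?A" using card_grid_V by simp
  have "grid_E ls \<subseteq> ?f ` ?A" by (auto simp: grid_E_def)
  then have "card (grid_E ls) \<le> card (?f ` ?A)" using fin by (intro card_mono) auto
  also have "\<dots> \<le> card ?A" by (rule card_image_le[OF fin])
  finally show ?thesis by (simp add: card_cartesian_product)
qed

lemma grid_E_sub: "grid_E ls \<subseteq> grid_V ls \<times> grid_V ls"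
  by (auto simp: grid_E_def)

text \<open>The coordinate sum is a rank function: it excludes self-loops and repeated nodes on a
  path.\<close>

lemma grid_E_sum: "(x, y) \<in> grid_E ls \<Longrightarrow> sum_list y = Suc (sum_list x)"
  by (auto simp: grid_E_def grid_V_def sum_list_update)

lemma grid_E_irrefl: "(v, v) \<notin> grid_E ls"
  using grid_E_sum by fastforce

text \<open>Coordinate sums increase along a path, so its nodes are pairwise distinct and there are
  at most \<open>grid_n ls\<close> of them.\<close>

lemma gdist_grid_le:
  assumes "u \<in> grid_V ls" "reachable (grid_E ls) u v"
  shows "gdist (grid_E ls) u v \<le> grid_n ls"
proof -
  let ?E = "grid_E ls"
  obtain p where p: "is_path ?E p" "hd p = u" "length p = Suc (gdist ?E u v)"
    using shortest_path_exists[OF assms(2)] by blast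
  have sum: "sum_list (p ! i) = sum_list u + i" if "i < length p" for i
    using that
  proof (induction i)
    case 0
    then show ?case using p by (cases p) auto
  next
    case (Suc i)
    then show ?case using p(1) by (auto simp: is_path_def dest!: grid_E_sum)
  qed
  have "p ! i \<in> grid_V ls" if "i < length p" for i
  proof -
    have "take (Suc i) p \<noteq> []" using that by auto
    then have "reachable ?E (hd (take (Suc i) p)) (last (take (Suc i) p))"
      using p(1) by (intro lazy_walk_reachable) (auto simp: is_path_def)
    then have "reachable ?E u (p ! i)"
      using p(2) that by (simp only: hd_take zero_less_Suc) (simp add: take_Suc_conv_app_nth)
    then show ?thesis using assms(1) grid_E_sub by (rule reachable_mem)
  qed
  moreover have "inj_on ((!) p) {..<length p}"
    using sum by (intro inj_onI) (metis add_left_cancel lessThan_iff)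
  ultimately have "card {..<length p} \<le> card (grid_V ls)"
    using card_grid_V by (intro card_inj_on_le[of "(!) p"]) auto
  then show ?thesis using p(3) card_grid_V[of ls] by simp
qed

text \<open>Positive side lengths put the origin into the grid, so the set under \<open>Max\<close>
  is nonempty.\<close>

lemma diam_grid_le:
  assumes "\<forall>j<length ls. 1 \<le> ls ! j"
  shows "diam (grid_V ls) (grid_E ls) \<le> grid_n ls"
proof -
  let ?S = "{gdist (grid_E ls) u v | u v. u \<in> grid_V ls \<and> v \<in> grid_V ls \<and> reachable (grid_E ls) u v}"
  have le: "x \<le> grid_n ls" if "x \<in> ?S" for x using that gdist_grid_le by auto
  have "replicate (length ls) 0 \<in> grid_V ls" using assms by (fastforce simp: grid_V_def)
  moreover have "reachable (grid_E ls) u u" for u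
    using lazy_walk_reachable[of "[u]"] by simp
  ultimately have "?S \<noteq> {}" by blast
  moreover have "finite ?S" using le by (auto intro: finite_subset[of _ "{..grid_n ls}"])
  ultimately show ?thesis unfolding diam_def using le by (intro Max.boundedI) auto
qed

lemma grid_n_ge: "\<forall>j<length ls. 1 \<le> ls ! j \<Longrightarrow> 1 \<le> grid_n ls"
proof -
  assume "\<forall>j<length ls. 1 \<le> ls ! j"
  then have "0 \<notin> set ls" by (auto simp: in_set_conv_nth)
  then have "prod_list ls \<noteq> 0" by (simp add: prod_list_zero_iff)
  then show ?thesis by (simp add: grid_n_def)
qed

section \<open>Onlineness and the case of diameter 0\<close>

lemma online_prefix:
  assumes "\<And>xs ys i. i < length xs \<Longrightarrow> ALG (xs @ ys) ! i = ALG xs ! i"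
  shows "online ls ALG"
  unfolding online_def
proof (intro allI impI)
  fix \<sigma> \<sigma>' :: "request list" and \<tau> i
  let ?t = "takeWhile (\<lambda>r. tin r \<le> \<tau>)"
  assume eq: "valid_input ls \<sigma> \<and> valid_input ls \<sigma>' \<and> ?t \<sigma> = ?t \<sigma>'" and i: "i < length (?t \<sigma>)"
  \<comment> \<open>Splitting \<open>\<rho>\<close> into its \<open>takeWhile\<close> and
    \<open>dropWhile\<close> parts shows that the prefix determines the whole walk, not just its
    part up to \<open>\<tau> + 1\<close>.\<close>
  have "ALG \<rho> ! i = ALG (?t \<rho>) ! i" if "i < length (?t \<rho>)" for \<rho>
    using assms[OF that, of "dropWhile (\<lambda>r. tin r \<le> \<tau>) \<rho>"] by simp
  then have "ALG \<sigma> ! i = ALG \<sigma>' ! i" using eq i by metis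
  then show "take (Suc (Suc \<tau>) - tin (\<sigma> ! i)) (ALG \<sigma> ! i) = take (Suc (Suc \<tau>) - tin (\<sigma> ! i)) (ALG \<sigma>' ! i)"
    by simp
qed

text \<open>With diameter 0 a packet can only be delivered if its source is its destination, and
  then the one-node walk delivers it immediately.\<close>

lemma diam_0_rejecting_optimal:
  assumes "finite V" "E \<subseteq> V \<times> V" "diam V E = 0" "\<And>r. r \<in> set \<sigma> \<Longrightarrow> src r \<in> V" "feasible E c B \<sigma> ws"
  shows "throughput \<sigma> ws \<le> throughput \<sigma> (map (\<lambda>r. [src r]) \<sigma>)"
  unfolding throughput_eq
proof (intro sum_mono)
  fix i assume "i \<in> {..<length \<sigma>}"
  then have i: "i < length \<sigma>" by simp
  have "delivers (\<sigma> ! i) [src (\<sigma> ! i)]" if del: "delivers (\<sigma> ! i) (ws ! i)"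
  proof -
    let ?u = "src (\<sigma> ! i)" and ?v = "dst (\<sigma> ! i)"
    have vt: "valid_traj E (\<sigma> ! i) (ws ! i)" using assms(5) i by (simp add: feasible_def)
    then have ne: "ws ! i \<noteq> []" "hd (ws ! i) = ?u" by (auto simp: valid_traj_def)
    have "reachable E ?u ?v"
      using vt del ne valid_traj_reachable(2)[OF vt, of 0] by (simp add: delivers_def hd_conv_nth)
    moreover from this have "?v \<in> V" using assms(2) assms(4)[OF nth_mem[OF i]] by (auto intro: reachable_mem)
    ultimately have g: "gdist E ?u ?v = 0" "reachable E ?u ?v"
      using gdist_le_diam[OF assms(1), of ?u ?v E] assms(3,4) i by auto
    then obtain p where "hd p = ?u" "last p = ?v" "length p = Suc 0"
      using shortest_path_exists by metis
    then have "?u = ?v" by (cases p) auto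
    moreover have "enat (tin (\<sigma> ! i)) \<le> enat (tin (\<sigma> ! i) + length (ws ! i) - 1)"
      using ne by (cases "ws ! i") auto
    then have "enat (tin (\<sigma> ! i)) \<le> dl (\<sigma> ! i)" using del unfolding delivers_def by (meson order_trans)
    ultimately show ?thesis by (simp add: delivers_def)
  qed
  then show "of_bool (delivers (\<sigma> ! i) (ws ! i)) \<le> (of_bool (delivers (\<sigma> ! i) (map (\<lambda>r. [src r]) \<sigma> ! i)) :: nat)"
    using i by auto
qed

lemma feasible_rejecting: "feasible E c B \<sigma> (map (\<lambda>r. [src r]) \<sigma>)"
proof -
  have "steps \<sigma> (map (\<lambda>r. [src r]) \<sigma>) \<tau> u v = {}" for \<tau> u v
    by (auto simp: steps_def)
  then show ?thesis by (simp add: feasible_def valid_traj_def)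
qed

section \<open>Logarithmic bound on \<open>k_par\<close>\<close>

lemma pmax_par_le:
  assumes "\<forall>j<length ls. 1 \<le> ls ! j" "0 \<le> C" "real B / real c \<le> real (grid_n ls) powr C"
  shows "pmax_par ls B c \<le> (2 * length ls + 4) * real (grid_n ls) powr (2 + C)"
proof -
  define n where "n = real (grid_n ls)"
  have n: "1 \<le> n" using grid_n_ge[OF assms(1)] by (simp add: n_def)
  define m where "m = n powr C"
  have m: "1 \<le> m" using n assms(2) by (simp add: m_def ge_one_powr_ge_zero)
  have nm: "1 \<le> n * m" using n m mult_mono[of 1 n 1 m] by simp
  have "nu_par ls B c \<le> 2 * n * (length ls * m + m)"
    using assms(3) n m unfolding nu_par_def n_def[symmetric] m_def[symmetric]
    by (intro mult_left_mono add_mono) (auto simp: mult_le_cancel_left1)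
  \<comment> \<open>Since \<open>n * m \<ge> 1\<close>, the added 2 is absorbed into
    \<open>2 * (n * m)\<close>, which turns \<open>2 * length ls + 2\<close> into
    \<open>2 * length ls + 4\<close>.\<close>
  then have "nu_par ls B c + 2 \<le> (2 * length ls + 4) * (n * m)"
    using nm by (simp add: algebra_simps)
  moreover have "real (diam (grid_V ls) (grid_E ls)) \<le> n"
    using diam_grid_le[OF assms(1)] by (simp add: n_def)
  ultimately have "pmax_par ls B c \<le> (2 * length ls + 4) * (n * m) * n"
    unfolding pmax_par_def using nm by (intro mult_mono) auto
  also have "\<dots> = (2 * length ls + 4) * n powr (2 + C)"
    using n by (simp add: m_def powr_add powr_numeral power2_eq_square)
  finally show ?thesis by (simp add: n_def)
qed

lemma k_par_le:
  assumes "\<forall>j<length ls. 1 \<le> ls ! j" "0 \<le> C" "real B / real c \<le> real (grid_n ls) powr C"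
  shows "k_par ls B c \<le> 1 + log 2 (6 * length ls + 13) + (2 + C) * log 2 (grid_n ls)"
proof -
  let ?n = "real (grid_n ls)"
  have n: "1 \<le> ?n" using grid_n_ge[OF assms(1)] by simp
  have m: "1 \<le> ?n powr (2 + C)" using n assms(2) by (simp add: ge_one_powr_ge_zero)
  have p0: "0 \<le> pmax_par ls B c" by (simp add: pmax_par_def nu_par_def)
  \<comment> \<open>Tripling gives the coefficient \<open>6 * length ls + 12\<close>, and the
    leading 1 is at most the power of \<open>?n\<close>, whence 13.\<close>
  have "1 + 3 * pmax_par ls B c \<le> (6 * length ls + 13) * ?n powr (2 + C)"
    using pmax_par_le[OF assms] m by (simp add: algebra_simps)
  then have "log 2 (1 + 3 * pmax_par ls B c) \<le> log 2 ((6 * length ls + 13) * ?n powr (2 + C))"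
    using p0 by simp
  also have "\<dots> = log 2 (6 * length ls + 13) + (2 + C) * log 2 ?n"
    using n by (simp add: log_mult log_powr)
  finally show ?thesis unfolding k_par_def by linarith
qed

section \<open>Choice of the parameters and the competitive ratio\<close>

lemma competitive_grid_alg:
  fixes ls B c
  defines "D \<equiv> diam (grid_V ls) (grid_E ls)"
  assumes "1 \<le> length ls" "\<forall>j<length ls. 1 \<le> ls ! j" "1 \<le> c" "1 \<le> D"
    and "k_par ls B c \<le> B" "k_par ls B c \<le> c"
  obtains ALG where "online ls ALG" "competitive ls c B ALG (1 + 4 * k_par ls B c)"
    "\<And>\<sigma>. no_preemption \<sigma> (ALG \<sigma>)"
proof -
  define P k \<nu> n where "P = pmax_par ls B c" and "k = nat (k_par ls B c)"
    and "\<nu> = nu_par ls B c" and "n = real (grid_n ls)"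
  have n: "1 \<le> n" using grid_n_ge[OF assms(3)] by (simp add: n_def)
  have c: "0 < real c" using assms(4) by simp
  have nu: "0 \<le> \<nu>" by (simp add: \<nu>_def nu_par_def)
  have P: "P = (\<nu> + 2) * D" by (simp add: P_def pmax_par_def \<nu>_def D_def)
  have "1 * 1 \<le> (\<nu> + 2) * D" using nu assms(5) by (intro mult_mono) auto
  then have P1: "1 \<le> P" by (simp add: P)
  have "0 < log 2 (1 + 3 * P)" using P1 by simp
  then have k1: "1 \<le> k_par ls B c" unfolding k_par_def P_def[symmetric] by linarith
  have "log 2 (1 + 3 * P) \<le> k" using k1 by (simp add: k_def k_par_def P_def)
  then have Pk: "1 + 3 * P \<le> 2 ^ k" using P1 by (simp add: log_le_iff powr_realpow)
  interpret network "grid_V ls" "grid_E ls" c B k P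
    using card_grid_V grid_E_sub grid_E_irrefl k1 assms(6,7) P1 Pk by unfold_locales (auto simp: k_def)
  \<comment> \<open>\<open>c * x\<close> is \<open>D * (n * B + n * length ls * c)\<close>, an upper
    bound for \<open>D\<close> times the number of packets under way, as \<open>S_ge\<close>
    requires.\<close>
  define x where "x = D * (n * (length ls + B / c))"
  define S where "S = nat \<lceil>x\<rceil>"
  have "0 < n * (length ls + B / c)" using n c assms(2) by (intro mult_pos_pos add_pos_nonneg) auto
  then have x: "0 < x" using assms(5) by (simp add: x_def)
  have S1: "1 \<le> S" using x unfolding S_def by linarith
  have xS: "x \<le> S" "S < x + 1" using x by (auto simp: S_def) linarith
  have "\<nu> * D = 2 * x" by (simp add: \<nu>_def nu_par_def x_def n_def)
  \<comment> \<open>Here \<open>P = 2 * x + 2 * D\<close>, while \<open>S + D < x + 1 + D\<close>;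
    the 1 is absorbed by \<open>D \<ge> 1\<close>.\<close>
  then have "S + D \<le> P" using xS(2) x assms(5) unfolding P by (simp add: algebra_simps)
  then have SP: "real (S + diam (grid_V ls) (grid_E ls)) \<le> P" by (simp add: D_def)
  have V: "real (card (grid_V ls)) \<le> n" using card_grid_V[of ls] by (simp add: n_def)
  have "real (card (grid_E ls)) \<le> real (card (grid_V ls) * length ls)" using card_grid_E of_nat_mono by blast
  also have "\<dots> \<le> n * length ls" using V by (simp add: mult_right_mono)
  finally have "real (card (grid_V ls)) * B + real (card (grid_E ls)) * c \<le> n * B + n * length ls * c"
    using V by (intro add_mono mult_right_mono) auto
  then have "real D * (real (card (grid_V ls)) * B + real (card (grid_E ls)) * c) \<le> D * (n * B + n * length ls * c)"
    by (intro mult_left_mono) auto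
  also have "\<dots> = c * x" using c by (simp add: x_def field_simps)
  also have "\<dots> \<le> c * S" using xS(1) c by simp
  finally have "real (D * (card (grid_V ls) * B + card (grid_E ls) * c)) \<le> real (c * S)" by simp
  then have SG: "diam (grid_V ls) (grid_E ls) * (card (grid_V ls) * B + card (grid_E ls) * c) \<le> c * S"
    unfolding D_def of_nat_le_iff .
  have "online ls alg" by (rule online_prefix) (rule alg_append)
  moreover have "competitive ls c B alg (1 + 4 * k_par ls B c)"
    unfolding competitive_def
  proof (intro allI impI conjI feasible_alg)
    fix \<sigma> assume "valid_input ls \<sigma>"
    then have src: "src r \<in> grid_V ls" if "r \<in> set \<sigma>" for r
      using that by (auto simp: valid_input_def valid_request_def)
    have "real_of_int (1 + 4 * k_par ls B c) = real (1 + 4 * k)" using k1 by (simp add: k_def)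
    then show "real (OPT (grid_E ls) c B \<sigma>) \<le> real_of_int (1 + 4 * k_par ls B c) * real (throughput \<sigma> (alg \<sigma>))"
      using throughput_le_alg[OF _ src S1 SP SG] by (intro OPT_le[OF feasible_alg]) simp
  qed
  ultimately show thesis using that no_preemption_alg by blast
qed

lemma competitive_mono:
  "competitive ls c B ALG \<rho> \<Longrightarrow> \<rho> \<le> \<rho>' \<Longrightarrow> competitive ls c B ALG \<rho>'"
  unfolding competitive_def by (meson mult_right_mono of_nat_0_le_iff order_trans)

theorem theorem6p3:
  fixes d :: nat and C :: real
  assumes "d \<ge> 1" and "C > 0"
  shows "\<exists>K>0. \<forall>(ls :: nat list) (B :: nat) (c :: nat).
     length ls = d \<and> (\<forall>j<d. ls ! j \<ge> 1) \<and> c \<ge> 1 \<and>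
     real B / real c \<le> real (grid_n ls) powr C \<and>
     int B \<ge> k_par ls B c \<and> int c \<ge> k_par ls B c \<longrightarrow>
     (\<exists>ALG. online ls ALG \<and>
        competitive ls c B ALG (K * (1 + log 2 (real (grid_n ls)))) \<and>
        (\<forall>\<sigma>. valid_input ls \<sigma> \<longrightarrow> no_preemption \<sigma> (ALG \<sigma>)))"
proof -
  define a where "a = log 2 (6 * d + 13)"
  \<comment> \<open>The ratio \<open>1 + 4 * k_par ls B c\<close> will be at most
    \<open>5 + 4 * a + (8 + 4 * C) * L\<close>; \<open>K\<close> is the sum of the two coefficients
    and so dominates both.\<close>
  define K where "K = 13 + 4 * a + 4 * C"
  have a: "0 \<le> a" by (simp add: a_def)
  have K: "1 \<le> K" using a assms(2) by (simp add: K_def)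
  show ?thesis
  proof (rule exI[of _ K], intro conjI allI impI)
    fix ls :: "nat list" and B c :: nat
    assume A: "length ls = d \<and> (\<forall>j<d. ls ! j \<ge> 1) \<and> c \<ge> 1 \<and>
     real B / real c \<le> real (grid_n ls) powr C \<and>
     int B \<ge> k_par ls B c \<and> int c \<ge> k_par ls B c"
    then have ls: "\<forall>j<length ls. 1 \<le> ls ! j" by simp
    define L where "L = log 2 (real (grid_n ls))"
    have L: "0 \<le> L" using grid_n_ge[OF ls] by (simp add: L_def)
    show "\<exists>ALG. online ls ALG \<and> competitive ls c B ALG (K * (1 + log 2 (real (grid_n ls)))) \<and>
        (\<forall>\<sigma>. valid_input ls \<sigma> \<longrightarrow> no_preemption \<sigma> (ALG \<sigma>))"
    \<comment> \<open>Diameter 0 makes \<open>pmax_par\<close> vanish, which violates the assumption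
      \<open>1 \<le> P\<close> of \<open>network\<close>; leaving every packet at its source is then
      optimal.\<close>
    proof (cases "diam (grid_V ls) (grid_E ls) = 0")
      case True
      let ?ALG = "map (\<lambda>r. [src r])"
      have "online ls ?ALG" by (rule online_prefix) (simp add: nth_append)
      moreover have "competitive ls c B ?ALG 1"
        unfolding competitive_def
      proof (intro allI impI conjI feasible_rejecting OPT_le[OF feasible_rejecting])
        fix \<sigma> ws assume "valid_input ls \<sigma>" "feasible (grid_E ls) c B \<sigma> ws"
        then have "throughput \<sigma> ws \<le> throughput \<sigma> (?ALG \<sigma>)"
          using card_grid_V True grid_E_sub
          by (intro diam_0_rejecting_optimal) (auto simp: valid_input_def valid_request_def)
        then show "real (throughput \<sigma> ws) \<le> 1 * real (throughput \<sigma> (?ALG \<sigma>))" by simp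
      qed
      moreover have "1 * 1 \<le> K * (1 + L)" using K L by (intro mult_mono) auto
      ultimately show ?thesis
        using competitive_mono by (intro exI[of _ ?ALG]) (auto simp: no_preemption_def L_def)
    next
      case False
      then obtain ALG where ALG: "online ls ALG" "competitive ls c B ALG (1 + 4 * k_par ls B c)"
        "\<And>\<sigma>. no_preemption \<sigma> (ALG \<sigma>)"
        using competitive_grid_alg[of ls c B] A assms(1) by (auto simp: Suc_le_eq)
      have "k_par ls B c \<le> 1 + a + (2 + C) * L"
        using k_par_le[OF ls, of C B c] A assms(2) by (simp add: a_def L_def)
      then have "real_of_int (1 + 4 * k_par ls B c) \<le> 5 + 4 * a + (8 + 4 * C) * L"
        by (simp add: algebra_simps)
      also have "\<dots> \<le> K + K * L"
        using a L assms(2) by (intro add_mono mult_right_mono) (auto simp: K_def)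
      finally have "real_of_int (1 + 4 * k_par ls B c) \<le> K * (1 + L)" by (simp add: algebra_simps)
      then show ?thesis using ALG competitive_mono unfolding L_def by blast
    qed
  qed (use K in simp)
qed

end
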